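(* Let $X=\{2^n : n\in\mathbb{N}\}$, $d(x,y)=|x-y|$ and $T\colon X\to X$, $T(x)=2x$. Then $(X,d)$ is a complete metric space and $T$ does not have fixed points. Furthermore, for every integer $k\ge 2$ there exists $q\in(0,1)$ such that for all $x,y\in X$ \[ d(Tx,Ty)\le q\cdot\max\{d(x,y),\,d(Tx,x),\,d(Tx,y),\,d(Ty,x),\,d(Ty,y),\,d(T^2x,x),\,d(T^2x,y),\,d(T^2x,Tx),\,d(T^2x,Ty),\,d(T^{k+1}x,T^k y)\}. \]
   Context: $\mathbb{N}$ is the set of natural numbers. For an integer $k\ge 0$, $T^k$ denotes the $k$-th iterate of $T$ (with $T^0$ the identity), and $Tx$ means $T(x)$. *)

theory Defs
  imports "HOL-Analysis.Abstract_Metric_Spaces"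
begin

definition X :: "real set" where
  "X = {2 ^ n | n :: nat. True}"

definition d :: "real \<Rightarrow> real \<Rightarrow> real" where
  "d x y = \<bar>x - y\<bar>"

definition T :: "real \<Rightarrow> real" where
  "T x = 2 * x"

end

theory Submission imports Defs begin

text \<open>
  Distinct powers of two differ by at least one, so Cauchy sequences in \<open>X\<close> are eventually
  constant. For the contraction condition \<open>q = 3/4\<close> works for every \<open>k \<ge> 2\<close>. If \<open>y \<le> x\<close>, the term
  \<open>d (T\<^sup>2x) y = 4x - y\<close> suffices; if \<open>y = 2x\<close>, the term \<open>d (Ty) x = 3x\<close> does. Otherwise \<open>4x \<le> y\<close>,
  and the last term is \<open>2\<^sup>k(y - 2x) \<ge> 4(y - 2x)\<close>.
\<close>

lemma X_pos: "x \<in> X \<Longrightarrow> 0 < x"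
  by (auto simp: X_def)

lemma X_subset_Ints: "X \<subseteq> \<int>"
  by (auto simp: X_def)

lemma T_in_X: "x \<in> X \<Longrightarrow> T x \<in> X"
  unfolding X_def T_def by (auto intro: exI[of _ "Suc _"])

lemma funpow_T: "(T ^^ n) x = 2 ^ n * x"
  by (induction n) (auto simp: T_def)

text \<open>Strictly larger exponents differ by at least one, hence no element of \<open>X\<close>
  lies strictly between \<open>x\<close> and \<open>T x\<close>.\<close>

lemma T_le_of_less:
  assumes "x \<in> X" "y \<in> X" "x < y"
  shows "T x \<le> y"
proof -
  obtain m n where mn: "x = 2 ^ m" "y = 2 ^ n"
    using assms by (auto simp: X_def)
  then have "Suc m \<le> n"
    using assms(3) by simp
  then have "(2::real) ^ Suc m \<le> 2 ^ n"
    by (rule power_increasing) simp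
  then show ?thesis
    by (simp add: mn T_def)
qed

lemma X_eq_of_d_less_1:
  assumes "x \<in> X" "y \<in> X" "d x y < 1"
  shows "x = y"
proof -
  have "x - y \<in> \<int>"
    using assms X_subset_Ints by (blast intro: Ints_diff)
  then show ?thesis
    using assms(3) Ints_nonzero_abs_less1[of "x - y"] by (simp add: d_def)
qed

lemma Metric_space_X: "Metric_space X d"
  by unfold_locales (auto simp: d_def)

lemma mcomplete_X: "Metric_space.mcomplete X d"
proof -
  interpret Metric_space X d
    by (rule Metric_space_X)
  have "\<exists>x. limitin mtopology \<sigma> x sequentially" if \<sigma>: "MCauchy \<sigma>" for \<sigma>
  proof -
    have ran: "\<sigma> n \<in> X" for n
      using \<sigma> by (auto simp: MCauchy_def)
    \<comment> \<open>The Cauchy condition is taken at radius 1, the threshold of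
      \<open>X_eq_of_d_less_1\<close>.\<close>
    obtain N where N: "\<And>n n'. N \<le> n \<Longrightarrow> N \<le> n' \<Longrightarrow> d (\<sigma> n) (\<sigma> n') < 1"
      using \<sigma> unfolding MCauchy_def by (meson zero_less_one)
    have "eventually (\<lambda>n. \<sigma> n = \<sigma> N) sequentially"
      unfolding eventually_sequentially using X_eq_of_d_less_1[OF ran ran N] by blast
    then have "limitin mtopology \<sigma> (\<sigma> N) sequentially"
      using ran by (intro limitin_eventually) auto
    then show ?thesis
      by blast
  qed
  then show ?thesis
    by (simp add: mcomplete_def)
qed

text \<open>The existential form, with one witness per case, is what \<open>le_mult_Max\<close>
  turns into a bound by the full maximum.\<close>

lemma T_contraction_cases:
  assumes x: "x \<in> X" and y: "y \<in> X" and k: "2 \<le> k"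
  shows "\<exists>m\<in>{d ((T ^^ 2) x) y, d (T y) x, d ((T ^^ (k + 1)) x) ((T ^^ k) y)}.
    d (T x) (T y) \<le> 3/4 * m"
proof -
  have pos: "0 < x" "0 < y"
    using x y X_pos by auto
  \<comment> \<open>Exhaustive because \<open>x < y\<close> already forces
    \<open>T x \<le> y\<close>.\<close>
  consider "y \<le> x" | "y = T x" | "T x < y"
    using T_le_of_less[OF x y] by linarith
  then show ?thesis
  proof cases
    case 1
    then have "d (T x) (T y) \<le> 3/4 * d ((T ^^ 2) x) y"
      using pos unfolding d_def funpow_T T_def by (simp add: abs_if)
    then show ?thesis by blast
  next
    case 2
    \<comment> \<open>Here the left side is \<open>2 * x\<close> and the right side is
      \<open>9/4 * x\<close>.\<close>
    then have "d (T x) (T y) \<le> 3/4 * d (T y) x"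
      using pos by (simp add: d_def T_def)
    then show ?thesis by blast
  next
    case 3
    \<comment> \<open>The gap property applied again, now to \<open>T x < y\<close>, gains a second
      factor 2.\<close>
    then have le: "4 * x \<le> y"
      using T_le_of_less[OF T_in_X[OF x] y] by (simp add: T_def)
    have "(2::real) ^ 2 \<le> 2 ^ k"
      using k by (intro power_increasing) auto
    then have "4 * (y - 2 * x) \<le> 2 ^ k * (y - 2 * x)"
      using le pos by (intro mult_right_mono) auto
    also have "\<dots> = d ((T ^^ (k + 1)) x) ((T ^^ k) y)"
    proof -
      have "(T ^^ (k + 1)) x - (T ^^ k) y = - (2 ^ k * (y - 2 * x))"
        unfolding funpow_T by (simp add: algebra_simps)
      moreover have "0 \<le> 2 ^ k * (y - 2 * x)"
        using le pos by simp
      ultimately show ?thesis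
        unfolding d_def by simp
    qed
    \<comment> \<open>The chain reduces the claim to
      \<open>2 * (y - x) \<le> 3 * (y - 2 * x)\<close>, which is equivalent to
      \<open>4 * x \<le> y\<close>.\<close>
    finally have "d (T x) (T y) \<le> 3/4 * d ((T ^^ (k + 1)) x) ((T ^^ k) y)"
      using le pos by (simp add: d_def T_def)
    then show ?thesis by blast
  qed
qed

lemma le_mult_Max:
  fixes c :: real
  assumes "\<exists>m\<in>B. a \<le> c * m" "B \<subseteq> A" "finite A" "0 \<le> c"
  shows "a \<le> c * Max A"
  using assms by (meson Max_ge mult_left_mono order_trans subsetD)

theorem claim2:
  shows "Metric_space X d \<and> Metric_space.mcomplete X d
    \<and> T \<in> X \<rightarrow> X
    \<and> \<not> (\<exists>x\<in>X. T x = x)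
    \<and> (\<forall>k::nat. k \<ge> 2 \<longrightarrow> (\<exists>q::real. q \<in> {0<..<1} \<and> (\<forall>x\<in>X. \<forall>y\<in>X.
          d (T x) (T y) \<le> q * Max {d x y, d (T x) x, d (T x) y, d (T y) x, d (T y) y,
            d ((T ^^ 2) x) x, d ((T ^^ 2) x) y, d ((T ^^ 2) x) (T x), d ((T ^^ 2) x) (T y),
            d ((T ^^ (k + 1)) x) ((T ^^ k) y)})))"
proof (intro conjI allI impI)
  show "T \<in> X \<rightarrow> X"
    by (auto intro: T_in_X)
  show "\<not> (\<exists>x\<in>X. T x = x)"
    by (auto simp: T_def dest: X_pos)
next
  fix k :: nat
  assume k: "2 \<le> k"
  show "\<exists>q::real. q \<in> {0<..<1} \<and> (\<forall>x\<in>X. \<forall>y\<in>X.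
          d (T x) (T y) \<le> q * Max {d x y, d (T x) x, d (T x) y, d (T y) x, d (T y) y,
            d ((T ^^ 2) x) x, d ((T ^^ 2) x) y, d ((T ^^ 2) x) (T x), d ((T ^^ 2) x) (T y),
            d ((T ^^ (k + 1)) x) ((T ^^ k) y)})"
    \<comment> \<open>The three candidate terms all occur among those under
      \<open>Max\<close>.\<close>
    by (intro exI[of _ "3/4"] conjI ballI le_mult_Max[OF T_contraction_cases[OF _ _ k]])
      (blast | simp)+
qed (rule Metric_space_X mcomplete_X)+

end
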